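(* Let $\mathcal V$ be a finite-dimensional real inner product space with induced norm $\|\cdot\|_2$, let $a\in\mathcal V$, $a\neq0$, $b\in\mathbb R$, and let $C=\{x\in\mathcal V\mid\langle a,x\rangle\le b\}$ be a halfspace. Let $\gamma\in\mathbb R$, $h\in\mathcal V$, $Q_0>0$, $Q(z):=\frac12\|z\|_2^2+Q_0$, $E_{\gamma,h}(x):=-\frac{\gamma+\langle h,x\rangle}{Q(x)}$, and assume $\sup_{x\in C}E_{\gamma,h}(x)>0$. For real $\beta_1>0,\beta_2,\beta_3$ put $$r(\beta_1,\beta_2,\beta_3):=\frac{-\beta_2+\sqrt{\beta_2^2-4\beta_1\beta_3}}{2\beta_1},$$ and let $$e_1:=r\left(Q_0,\ \gamma,\ -\tfrac12\|h\|_2^2\right),\qquad e_2:=r\left(\frac{b^2}{2\|a\|_2^2}+Q_0,\ \frac{b\langle a,h\rangle}{\|a\|_2^2}+\gamma,\ \frac12\frac{\langle a,h\rangle^2}{\|a\|_2^2}-\frac12\|h\|_2^2\right).$$ Then the problem $\sup_{x\in C}E_{\gamma,h}(x)$ is solved by $u=P_C(-e^{-1}h)$, where $$P_C(y)=y-\frac{(\langle a,y\rangle-b)_+}{\|a\|_2^2}\,a$$ and the optimal value $e=E_{\gamma,h}(u)$ is given as follows: (i) if $\langle a,h\rangle\ge -e_1b$ and $\langle a,h\rangle\ge -e_2b$, then $e=e_1$; (ii) if $\langle a,h\rangle\le -e_1b$ and $\langle a,h\rangle<-e_2b$, then $e=e_2$; (iii) if $\langle a,h\rangle\ge -e_1b$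 and $\langle a,h\rangle<-e_2b$, then $e=\max\{e_1,e_2\}$.
   Context: $P_C(y):=\operatorname{argmin}_{x\in C}\frac12\|x-y\|_2^2$ denotes the orthogonal projection onto $C$; $(t)_+:=\max(t,0)$. "The problem is solved by $u$" means that $u\in C$ is a maximizer of $E_{\gamma,h}$ over $C$. *)

theory Defs
  imports "HOL-Analysis.Analysis"
begin

definition Q :: "real \<Rightarrow> 'v::real_inner \<Rightarrow> real" where
  "Q Q0 z = (1/2) * (norm z)\<^sup>2 + Q0"

definition E :: "real \<Rightarrow> real \<Rightarrow> 'v::real_inner \<Rightarrow> 'v \<Rightarrow> real" where
  "E Q0 \<gamma> h x = - ((\<gamma> + h \<bullet> x) / Q Q0 x)"

definition proj :: "'v::real_inner set \<Rightarrow> 'v \<Rightarrow> 'v" where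
  "proj C y = arg_min_on (\<lambda>x. (1/2) * (norm (x - y))\<^sup>2) C"

text \<open>Meant for \<open>\<beta>1 > 0\<close> and a nonnegative discriminant: the larger root of
  \<open>\<beta>1 t^2 + \<beta>2 t + \<beta>3\<close>.\<close>

definition r :: "real \<Rightarrow> real \<Rightarrow> real \<Rightarrow> real" where
  "r \<beta>1 \<beta>2 \<beta>3 = (- \<beta>2 + sqrt (\<beta>2\<^sup>2 - 4 * \<beta>1 * \<beta>3)) / (2 * \<beta>1)"

text \<open>\<open>E\<close> is bounded above on every set, so its real-valued supremum over a nonempty set
  is the least upper bound and not a junk value of \<open>Sup\<close>.\<close>

lemma bdd_above_E:
  fixes h :: "'v::real_inner"
  assumes "Q0 > 0"
  shows "bdd_above (E Q0 \<gamma> h ` S)"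
proof (rule bdd_aboveI2)
  fix x :: 'v
  let ?q = "Q Q0 x" and ?c = "\<bar>\<gamma>\<bar> / Q0 + norm h * (1 / (2 * Q0) + 1)"
  have q: "?q \<ge> Q0" by (simp add: Q_def)
  have "2 * norm x \<le> 1 + (norm x)\<^sup>2"
    using sum_squares_bound[of "norm x" 1] by simp
  then have n: "norm x \<le> 1/2 + ?q"
    using assms by (simp add: Q_def)
  have A: "\<bar>\<gamma>\<bar> \<le> (\<bar>\<gamma>\<bar> / Q0) * ?q"
    using mult_left_mono[OF q, of "\<bar>\<gamma>\<bar> / Q0"] assms by simp
  have "1/2 \<le> (1 / (2 * Q0)) * ?q"
    using mult_left_mono[OF q, of "1 / (2 * Q0)"] assms by simp
  with n have "norm x \<le> (1 / (2 * Q0) + 1) * ?q"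
    by (simp add: distrib_right)
  then have B: "norm h * norm x \<le> norm h * ((1 / (2 * Q0) + 1) * ?q)"
    by (intro mult_left_mono) auto
  have "- (\<gamma> + h \<bullet> x) \<le> \<bar>\<gamma>\<bar> + norm h * norm x"
    using Cauchy_Schwarz_ineq2[of h x] by linarith
  also have "\<dots> \<le> ?c * ?q"
    using A B by (simp add: algebra_simps)
  finally have "- (\<gamma> + h \<bullet> x) / ?q \<le> ?c"
    using q assms by (subst pos_divide_le_eq) auto
  then show "E Q0 \<gamma> h x \<le> ?c" unfolding E_def minus_divide_left .
qed

end

theory Submission
  imports Defs
begin

text \<open>
  The argument is Dinkelbach's parametrisation of a fractional programme. As \<open>Q > 0\<close>, a bound
  \<open>E x \<le> t\<close> says that \<open>t * Q x + \<gamma> + h \<bullet> x \<ge> 0\<close>, so the supremum \<open>e\<close> is governed by the sign of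
  the minimum of this convex quadratic over \<open>C\<close>. For \<open>t > 0\<close>, completing the square turns that
  minimisation into projecting \<open>- h / t\<close> onto \<open>C\<close>, and the explicit projection onto a halfspace
  evaluates the minimum (\<open>parametric_at_halfspace_proj\<close>, \<open>parametric_minimum\<close>): multiplied by
  \<open>t\<close>, it is
  \<open>Q0 * t\<^sup>2 + \<gamma> * t - (norm h)\<^sup>2 / 2 + (min (a \<bullet> h + t * b) 0)\<^sup>2 / (2 * (norm a)\<^sup>2)\<close>.
  This is continuous in \<open>t\<close>, negative for \<open>0 < t < e\<close> and nonnegative at \<open>e\<close>, hence zero at \<open>e\<close>,
  which makes the projected point a maximiser with value \<open>e\<close>.

  The function above agrees with the quadratic whose larger root is \<open>e1\<close> where
  \<open>a \<bullet> h + t * b \<ge> 0\<close>, and with the one whose larger root is \<open>e2\<close> elsewhere. Both quadratics have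
  a nonpositive constant term, so a positive root can only be the larger one
  (\<open>positive_root_eq_r\<close>); therefore \<open>e\<close> is \<open>e1\<close> or \<open>e2\<close> according to the sign of
  \<open>a \<bullet> h + e * b\<close>. Conversely, every positive zero of the function is a value of \<open>E\<close> on \<open>C\<close>, so it
  is at most \<open>e\<close>. This settles the case in which both quadratics are admissible.
\<close>

section \<open>Projection onto a halfspace\<close>

definition halfspace_proj :: "'v::real_inner \<Rightarrow> real \<Rightarrow> 'v \<Rightarrow> 'v" where
  "halfspace_proj a b y = y - (max (a \<bullet> y - b) 0 / (norm a)\<^sup>2) *\<^sub>R a"

lemma inner_halfspace_proj:
  assumes "a \<noteq> 0"
  shows "a \<bullet> halfspace_proj a b y = min (a \<bullet> y) b"
  using assms by (simp add: halfspace_proj_def inner_diff_right dot_square_norm max_def min_def)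

text \<open>The residual \<open>y - halfspace_proj a b y\<close> is a nonnegative multiple of the outward normal \<open>a\<close>,
  and it vanishes unless the projected point lies on the boundary. So it makes an obtuse angle with
  every direction pointing into the halfspace, and Pythagoras' theorem becomes an inequality.\<close>

lemma halfspace_proj_pythagoras:
  assumes "a \<noteq> 0" "a \<bullet> x \<le> b"
  shows "(norm (x - y))\<^sup>2 \<ge> (norm (halfspace_proj a b y - y))\<^sup>2 + (norm (x - halfspace_proj a b y))\<^sup>2"
proof -
  let ?p = "halfspace_proj a b y"
  define l where "l = max (a \<bullet> y - b) 0 / (norm a)\<^sup>2"
  have res: "y - ?p = l *\<^sub>R a"
    by (simp add: halfspace_proj_def l_def)
  have "(y - ?p) \<bullet> (x - ?p) = l * (a \<bullet> x - min (a \<bullet> y) b)"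
    by (simp add: res inner_diff_right inner_halfspace_proj[OF assms(1)] right_diff_distrib)
  also have "\<dots> \<le> 0"
  proof (cases "a \<bullet> y \<le> b")
    case True
    then show ?thesis by (simp add: l_def)
  next
    case False
    then show ?thesis using assms
      by (intro mult_nonneg_nonpos) (auto simp: l_def)
  qed
  finally have obtuse: "(y - ?p) \<bullet> (x - ?p) \<le> 0" .
  have "(norm (x - y))\<^sup>2 = (norm (?p - y))\<^sup>2 + (norm (x - ?p))\<^sup>2 - 2 * ((y - ?p) \<bullet> (x - ?p))"
    by (simp add: power2_norm_eq_inner inner_diff_left inner_diff_right inner_commute)
  with obtuse show ?thesis by linarith
qed

lemma proj_halfspace:
  assumes "a \<noteq> 0"
  shows "proj {x. a \<bullet> x \<le> b} y = halfspace_proj a b y"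
proof -
  let ?p = "halfspace_proj a b y"
  let ?f = "\<lambda>x. (1/2) * (norm (x - y))\<^sup>2"
  have mem: "a \<bullet> ?p \<le> b"
    by (simp add: inner_halfspace_proj[OF assms])
  have strict: "?f ?p < ?f x" if "a \<bullet> x \<le> b" "x \<noteq> ?p" for x
  proof -
    have "(norm (x - ?p))\<^sup>2 > 0" using that by simp
    then show ?thesis
      using halfspace_proj_pythagoras[OF assms that(1), of y] by linarith
  qed
  have "is_arg_min ?f (\<lambda>x. x \<in> {x. a \<bullet> x \<le> b}) x \<longleftrightarrow> x = ?p" for x
    unfolding is_arg_min_def using mem strict by (metis mem_Collect_eq less_asym)
  then show ?thesis
    by (simp add: proj_def arg_min_on_def arg_min_def)
qed

section \<open>The parametric problem\<close>

text \<open>For \<open>t > 0\<close> this is \<open>t\<close> times the minimum of \<open>t * Q x + \<gamma> + h \<bullet> x\<close> over the halfspace. The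
  factor \<open>t\<close> removes the denominators, which makes the function a quadratic polynomial on each side
  of the switching point \<open>a \<bullet> h + t * b = 0\<close>.\<close>

definition scaled_min :: "'v::real_inner \<Rightarrow> real \<Rightarrow> real \<Rightarrow> real \<Rightarrow> 'v \<Rightarrow> real \<Rightarrow> real" where
  "scaled_min a b Q0 \<gamma> h t =
     Q0 * t\<^sup>2 + \<gamma> * t - (norm h)\<^sup>2 / 2 + (min (a \<bullet> h + t * b) 0)\<^sup>2 / (2 * (norm a)\<^sup>2)"

lemma parametric_complete_square:
  assumes "t > 0"
  shows "t * (t * Q Q0 x + \<gamma> + h \<bullet> x) =
    t\<^sup>2 / 2 * (norm (x - (- (inverse t *\<^sub>R h))))\<^sup>2 + (Q0 * t\<^sup>2 + \<gamma> * t - (norm h)\<^sup>2 / 2)"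
proof -
  have "(norm (x - (- (inverse t *\<^sub>R h))))\<^sup>2
      = (norm x)\<^sup>2 + 2 * inverse t * (h \<bullet> x) + (inverse t)\<^sup>2 * (norm h)\<^sup>2"
    by (simp add: power2_norm_eq_inner inner_add_left inner_add_right inner_commute
        power2_eq_square[of "inverse t"] algebra_simps)
  then show ?thesis
    using assms by (simp add: Q_def field_simps power2_eq_square)
qed

lemma parametric_at_halfspace_proj:
  fixes a h :: "'v::real_inner" and b t :: real
  assumes "a \<noteq> 0" "t > 0"
  defines "p \<equiv> halfspace_proj a b (- (inverse t *\<^sub>R h))"
  shows "t * (t * Q Q0 p + \<gamma> + h \<bullet> p) = scaled_min a b Q0 \<gamma> h t"
proof -
  let ?y = "- (inverse t *\<^sub>R h)"
  let ?m = "max (a \<bullet> ?y - b) 0"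
  have "p - ?y = - ((?m / (norm a)\<^sup>2) *\<^sub>R a)"
    by (simp add: p_def halfspace_proj_def)
  then have "(norm (p - ?y))\<^sup>2 = (?m / (norm a)\<^sup>2)\<^sup>2 * (norm a)\<^sup>2"
    by (simp only: norm_minus_cancel norm_scaleR power_mult_distrib power2_abs)
  also have "\<dots> = ?m\<^sup>2 / (norm a)\<^sup>2"
    using assms by (simp add: field_simps power2_eq_square)
  finally have dist: "(norm (p - ?y))\<^sup>2 = ?m\<^sup>2 / (norm a)\<^sup>2" .
  have "t * ?m = - min (a \<bullet> h + t * b) 0"
    using assms(2) by (auto simp: max_def min_def field_simps)
  then have "t\<^sup>2 * ?m\<^sup>2 = (min (a \<bullet> h + t * b) 0)\<^sup>2"
    by (metis power_mult_distrib power2_minus)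
  then have "t\<^sup>2 / 2 * (norm (p - ?y))\<^sup>2 = (min (a \<bullet> h + t * b) 0)\<^sup>2 / (2 * (norm a)\<^sup>2)"
    unfolding dist by simp
  then show ?thesis
    unfolding parametric_complete_square[OF assms(2)] scaled_min_def by simp
qed

lemma parametric_minimum:
  assumes "a \<noteq> 0" "t > 0" "a \<bullet> x \<le> b"
  shows "scaled_min a b Q0 \<gamma> h t \<le> t * (t * Q Q0 x + \<gamma> + h \<bullet> x)"
proof -
  let ?y = "- (inverse t *\<^sub>R h)"
  have "(norm (halfspace_proj a b ?y - ?y))\<^sup>2 \<le> (norm (x - ?y))\<^sup>2"
    using halfspace_proj_pythagoras[OF assms(1,3), of ?y] zero_le_power2[of "norm (x - halfspace_proj a b ?y)"]
    by linarith
  then have "t\<^sup>2 / 2 * (norm (halfspace_proj a b ?y - ?y))\<^sup>2 \<le> t\<^sup>2 / 2 * (norm (x - ?y))\<^sup>2"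
    by (intro mult_left_mono) auto
  then show ?thesis
    unfolding parametric_at_halfspace_proj[OF assms(1,2), symmetric]
      parametric_complete_square[OF assms(2)] by simp
qed

lemma Q_pos: "Q0 > 0 \<Longrightarrow> Q Q0 x > 0"
  unfolding Q_def by (intro add_nonneg_pos) auto

lemma E_less_iff:
  assumes "Q0 > 0"
  shows "t < E Q0 \<gamma> h x \<longleftrightarrow> t * Q Q0 x + \<gamma> + h \<bullet> x < 0"
  unfolding E_def minus_divide_left
  by (subst pos_less_divide_eq[OF Q_pos[OF assms]]) linarith

lemma E_eq_iff:
  assumes "Q0 > 0"
  shows "E Q0 \<gamma> h x = t \<longleftrightarrow> t * Q Q0 x + \<gamma> + h \<bullet> x = 0"
proof -
  have "Q Q0 x \<noteq> 0" using Q_pos[OF assms] by (metis less_irrefl)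
  then show ?thesis
    unfolding E_def minus_divide_left by (subst nonzero_divide_eq_eq) auto
qed

lemma E_at_zero_of_scaled_min:
  assumes "a \<noteq> 0" "Q0 > 0" "t > 0" "scaled_min a b Q0 \<gamma> h t = 0"
  shows "E Q0 \<gamma> h (halfspace_proj a b (- (inverse t *\<^sub>R h))) = t"
  using parametric_at_halfspace_proj[OF assms(1,3), of Q0 b h \<gamma>] assms
  by (simp add: E_eq_iff)

text \<open>Zero is reached at the supremum because the sign changes there: below \<open>e\<close> some feasible point
  beats the parameter, at \<open>e\<close> none does, and \<open>scaled_min\<close> is continuous. Attainment
  of the supremum is a consequence, by \<open>E_at_zero_of_scaled_min\<close>.\<close>

lemma scaled_min_SUP_eq_0:
  fixes a h :: "'v::real_inner"
  assumes "a \<noteq> 0" "Q0 > 0"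
    and e: "e = (SUP x\<in>{x. a \<bullet> x \<le> b}. E Q0 \<gamma> h x)" "e > 0"
  shows "scaled_min a b Q0 \<gamma> h e = 0"
proof (rule antisym)
  let ?C = "{x. a \<bullet> x \<le> b}"
  have mem: "halfspace_proj a b y \<in> ?C" for y
    by (simp add: inner_halfspace_proj[OF assms(1)])
  then have nonempty: "E Q0 \<gamma> h ` ?C \<noteq> {}" by blast
  have below: "scaled_min a b Q0 \<gamma> h t \<le> 0" if t: "0 < t" "t < e" for t
  proof -
    obtain x where x: "a \<bullet> x \<le> b" "t < E Q0 \<gamma> h x"
      using less_cSupD[OF nonempty t(2)[unfolded e(1)]] by auto
    have "t * (t * Q Q0 x + \<gamma> + h \<bullet> x) \<le> 0"
      using x(2) t(1) by (intro mult_nonneg_nonpos) (auto simp: E_less_iff[OF assms(2)])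
    with parametric_minimum[OF assms(1) t(1) x(1), of Q0 \<gamma> h] show ?thesis by linarith
  qed
  have "continuous_on UNIV (scaled_min a b Q0 \<gamma> h)"
    unfolding scaled_min_def[abs_def] divide_inverse by (intro continuous_intros)
  then have "(scaled_min a b Q0 \<gamma> h \<longlongrightarrow> scaled_min a b Q0 \<gamma> h e) (at e)"
    by (simp add: continuous_on_def)
  then have "(scaled_min a b Q0 \<gamma> h \<longlongrightarrow> scaled_min a b Q0 \<gamma> h e) (at_left e)"
    by (rule tendsto_within_subset) simp
  moreover have "eventually (\<lambda>t. scaled_min a b Q0 \<gamma> h t \<le> 0) (at_left e)"
    using below e(2) eventually_at_left_real[OF e(2)] by (auto elim: eventually_mono)
  ultimately show "scaled_min a b Q0 \<gamma> h e \<le> 0"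
    by (intro tendsto_upperbound[OF _ _ trivial_limit_at_left_real])
  let ?p = "halfspace_proj a b (- (inverse e *\<^sub>R h))"
  have "E Q0 \<gamma> h ?p \<le> e"
    unfolding e(1) by (rule cSUP_upper[OF mem bdd_above_E[OF assms(2)]])
  then have "0 \<le> e * Q Q0 ?p + \<gamma> + h \<bullet> ?p"
    using E_less_iff[OF assms(2), of e \<gamma> h ?p] by linarith
  then show "0 \<le> scaled_min a b Q0 \<gamma> h e"
    using e(2) unfolding parametric_at_halfspace_proj[OF assms(1) e(2), symmetric]
    by (intro mult_nonneg_nonneg) auto
qed

section \<open>Roots of the two quadratics\<close>

lemma r_is_root:
  assumes "\<beta>1 > 0" "\<beta>3 \<le> 0"
  shows "\<beta>1 * (r \<beta>1 \<beta>2 \<beta>3)\<^sup>2 + \<beta>2 * r \<beta>1 \<beta>2 \<beta>3 + \<beta>3 = 0"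
proof -
  define D where "D = \<beta>2\<^sup>2 - 4 * \<beta>1 * \<beta>3"
  have "\<beta>1 * \<beta>3 \<le> 0" using assms by (intro mult_nonneg_nonpos) auto
  then have "D \<ge> 0" unfolding D_def using zero_le_power2[of \<beta>2] by linarith
  then have sq: "(sqrt D)\<^sup>2 = \<beta>2\<^sup>2 - 4 * \<beta>1 * \<beta>3" by (simp add: D_def)
  have root: "2 * \<beta>1 * r \<beta>1 \<beta>2 \<beta>3 + \<beta>2 = sqrt D"
    using assms(1) by (simp add: r_def D_def)
  have "4 * \<beta>1 * (\<beta>1 * (r \<beta>1 \<beta>2 \<beta>3)\<^sup>2 + \<beta>2 * r \<beta>1 \<beta>2 \<beta>3 + \<beta>3)
      = (2 * \<beta>1 * r \<beta>1 \<beta>2 \<beta>3 + \<beta>2)\<^sup>2 - \<beta>2\<^sup>2 + 4 * \<beta>1 * \<beta>3"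
    by (simp add: power2_eq_square algebra_simps)
  also have "\<dots> = 0" unfolding root sq by simp
  finally show ?thesis using assms(1) by simp
qed

text \<open>The roots have a nonpositive product \<open>\<beta>3 / \<beta>1\<close>, so at most one is positive. In terms of
  the formula: at a positive root \<open>t\<close> the derivative \<open>2 * \<beta>1 * t + \<beta>2\<close> is nonnegative, so it is the
  square root of the discriminant and not its negative.\<close>

lemma positive_root_eq_r:
  assumes "\<beta>1 > 0" "\<beta>3 \<le> 0" "t > 0" and root: "\<beta>1 * t\<^sup>2 + \<beta>2 * t + \<beta>3 = 0"
  shows "r \<beta>1 \<beta>2 \<beta>3 = t"
proof -
  have "t * (2 * \<beta>1 * t + \<beta>2) = \<beta>1 * t\<^sup>2 - \<beta>3"
    using root by (simp add: power2_eq_square algebra_simps)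
  also have "\<dots> \<ge> 0"
  proof -
    have "0 \<le> \<beta>1 * t\<^sup>2" using assms(1) by simp
    with assms(2) show ?thesis by linarith
  qed
  finally have "2 * \<beta>1 * t + \<beta>2 \<ge> 0"
    using assms(3) by (simp add: zero_le_mult_iff)
  moreover have "\<beta>2\<^sup>2 - 4 * \<beta>1 * \<beta>3 = (2 * \<beta>1 * t + \<beta>2)\<^sup>2"
  proof -
    have const: "\<beta>3 = - (\<beta>1 * t\<^sup>2 + \<beta>2 * t)" using root by linarith
    show ?thesis unfolding const by (simp add: power2_eq_square algebra_simps)
  qed
  ultimately have "sqrt (\<beta>2\<^sup>2 - 4 * \<beta>1 * \<beta>3) = 2 * \<beta>1 * t + \<beta>2" by simp
  then show ?thesis using assms(1) by (simp add: r_def)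
qed

text \<open>The sign of \<open>a \<bullet> h + t * b\<close> tells whether \<open>- h / t\<close> is feasible. The coefficients below are
  grouped as the arguments of \<open>r\<close> that define \<open>e1\<close> and \<open>e2\<close>.\<close>

lemma scaled_min_inactive:
  assumes "a \<bullet> h + t * b \<ge> 0"
  shows "scaled_min a b Q0 \<gamma> h t = Q0 * t\<^sup>2 + \<gamma> * t + (- (1/2) * (norm h)\<^sup>2)"
  using assms by (simp add: scaled_min_def)

lemma scaled_min_active:
  assumes "a \<noteq> 0" "a \<bullet> h + t * b \<le> 0"
  shows "scaled_min a b Q0 \<gamma> h t =
    (b\<^sup>2 / (2 * (norm a)\<^sup>2) + Q0) * t\<^sup>2 + (b * (a \<bullet> h) / (norm a)\<^sup>2 + \<gamma>) * t
      + ((1/2) * ((a \<bullet> h)\<^sup>2 / (norm a)\<^sup>2) - (1/2) * (norm h)\<^sup>2)"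
  using assms by (simp add: scaled_min_def min_absorb1 field_simps power2_eq_square)

lemma active_constant_term_nonpos:
  fixes a h :: "'v::real_inner"
  assumes "a \<noteq> 0"
  shows "(1/2) * ((a \<bullet> h)\<^sup>2 / (norm a)\<^sup>2) - (1/2) * (norm h)\<^sup>2 \<le> 0"
proof -
  have "(a \<bullet> h)\<^sup>2 \<le> (norm h)\<^sup>2 * (norm a)\<^sup>2"
    using Cauchy_Schwarz_ineq[of a h] by (simp add: power2_norm_eq_inner mult.commute)
  then have "(a \<bullet> h)\<^sup>2 / (norm a)\<^sup>2 \<le> (norm h)\<^sup>2"
    using assms by (simp add: pos_divide_le_eq)
  then show ?thesis by simp
qed

section \<open>The maximiser and the optimal value\<close>

theorem proposition3p3:
  fixes a h :: "'v::euclidean_space"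
    and b \<gamma> Q0 e1 e2 e :: real
    and C :: "'v set"
  assumes "a \<noteq> 0"
    and "Q0 > 0"
    and "C = {x. a \<bullet> x \<le> b}"
    and "e1 = r Q0 \<gamma> (- (1/2) * (norm h)\<^sup>2)"
    and "e2 = r (b\<^sup>2 / (2 * (norm a)\<^sup>2) + Q0)
                (b * (a \<bullet> h) / (norm a)\<^sup>2 + \<gamma>)
                ((1/2) * ((a \<bullet> h)\<^sup>2 / (norm a)\<^sup>2) - (1/2) * (norm h)\<^sup>2)"
    and "e = (SUP x\<in>C. E Q0 \<gamma> h x)"
    and "e > 0"
  shows "is_arg_max (E Q0 \<gamma> h) (\<lambda>x. x \<in> C) (proj C (- (inverse e *\<^sub>R h)))
    \<and> E Q0 \<gamma> h (proj C (- (inverse e *\<^sub>R h))) = e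
    \<and> (\<forall>y. proj C y = y - (max (a \<bullet> y - b) 0 / (norm a)\<^sup>2) *\<^sub>R a)
    \<and> (a \<bullet> h \<ge> - e1 * b \<and> a \<bullet> h \<ge> - e2 * b \<longrightarrow> e = e1)
    \<and> (a \<bullet> h \<le> - e1 * b \<and> a \<bullet> h < - e2 * b \<longrightarrow> e = e2)
    \<and> (a \<bullet> h \<ge> - e1 * b \<and> a \<bullet> h < - e2 * b \<longrightarrow> e = max e1 e2)"
proof -
  let ?g = "scaled_min a b Q0 \<gamma> h"
  let ?p = "\<lambda>t. halfspace_proj a b (- (inverse t *\<^sub>R h))"
  note C = \<open>C = {x. a \<bullet> x \<le> b}\<close>
  have proj: "proj C y = halfspace_proj a b y" for y
    unfolding C by (rule proj_halfspace[OF \<open>a \<noteq> 0\<close>])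
  have mem: "halfspace_proj a b y \<in> C" for y
    unfolding C by (simp add: inner_halfspace_proj[OF \<open>a \<noteq> 0\<close>])
  have upper: "E Q0 \<gamma> h x \<le> e" if "x \<in> C" for x
    unfolding \<open>e = _\<close> by (rule cSUP_upper[OF that bdd_above_E[OF \<open>Q0 > 0\<close>]])
  have g_e: "?g e = 0"
    using \<open>e = _\<close> unfolding C
    by (intro scaled_min_SUP_eq_0) (use \<open>a \<noteq> 0\<close> \<open>Q0 > 0\<close> \<open>e > 0\<close> in auto)
  have attained: "E Q0 \<gamma> h (?p e) = e"
    by (rule E_at_zero_of_scaled_min[OF \<open>a \<noteq> 0\<close> \<open>Q0 > 0\<close> \<open>e > 0\<close> g_e])
  have zero_le_e: "t \<le> e" if "t > 0" "?g t = 0" for t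
    using E_at_zero_of_scaled_min[OF \<open>a \<noteq> 0\<close> \<open>Q0 > 0\<close> that] upper[OF mem] by metis

  have lead_pos: "b\<^sup>2 / (2 * (norm a)\<^sup>2) + Q0 > 0"
    using \<open>Q0 > 0\<close> by (intro add_nonneg_pos) auto
  have const_nonpos: "- (1/2) * (norm h)\<^sup>2 \<le> 0" by simp
  note e1 = \<open>e1 = _\<close> and e2 = \<open>e2 = _\<close>

  have eq_e1: "e = e1" if "a \<bullet> h + e * b \<ge> 0"
    using positive_root_eq_r[OF \<open>Q0 > 0\<close> const_nonpos \<open>e > 0\<close>] g_e
    unfolding e1 scaled_min_inactive[OF that] by metis
  have eq_e2: "e = e2" if "a \<bullet> h + e * b \<le> 0"
    using positive_root_eq_r[OF lead_pos active_constant_term_nonpos[OF \<open>a \<noteq> 0\<close>] \<open>e > 0\<close>] g_e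
    unfolding e2 scaled_min_active[OF \<open>a \<noteq> 0\<close> that] by metis
  \<comment> \<open>A root that is not positive lies below \<open>e\<close> because \<open>e > 0\<close>.\<close>
  have e1_le: "e1 \<le> e" if "a \<bullet> h + e1 * b \<ge> 0"
  proof -
    have "?g e1 = 0"
      unfolding scaled_min_inactive[OF that]
      unfolding e1 by (rule r_is_root[OF \<open>Q0 > 0\<close> const_nonpos])
    then show ?thesis using zero_le_e \<open>e > 0\<close> by (cases "e1 > 0") auto
  qed
  have e2_le: "e2 \<le> e" if "a \<bullet> h + e2 * b \<le> 0"
  proof -
    have "?g e2 = 0"
      unfolding scaled_min_active[OF \<open>a \<noteq> 0\<close> that]
      unfolding e2 by (rule r_is_root[OF lead_pos active_constant_term_nonpos[OF \<open>a \<noteq> 0\<close>]])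
    then show ?thesis using zero_le_e \<open>e > 0\<close> by (cases "e2 > 0") auto
  qed

  show ?thesis
  proof (intro conjI impI allI)
    show "is_arg_max (E Q0 \<gamma> h) (\<lambda>x. x \<in> C) (proj C (- (inverse e *\<^sub>R h)))"
      unfolding is_arg_max_def proj using attained mem upper by (metis not_less)
    show "E Q0 \<gamma> h (proj C (- (inverse e *\<^sub>R h))) = e"
      unfolding proj by (rule attained)
    show "proj C y = y - (max (a \<bullet> y - b) 0 / (norm a)\<^sup>2) *\<^sub>R a" for y
      unfolding proj halfspace_proj_def ..
  next
    assume "a \<bullet> h \<ge> - e1 * b \<and> a \<bullet> h \<ge> - e2 * b"
    then show "e = e1" using eq_e1 eq_e2 by (cases "a \<bullet> h + e * b \<ge> 0") auto
  next
    assume "a \<bullet> h \<le> - e1 * b \<and> a \<bullet> h < - e2 * b"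
    \<comment> \<open>If the constraint were inactive at \<open>e\<close>, then \<open>e = e1\<close> would be the switching point, where
      the two quadratics agree.\<close>
    then show "e = e2" using eq_e1 eq_e2 by (cases "a \<bullet> h + e * b \<ge> 0") auto
  next
    assume "a \<bullet> h \<ge> - e1 * b \<and> a \<bullet> h < - e2 * b"
    then have "e1 \<le> e" "e2 \<le> e" using e1_le e2_le by auto
    moreover have "e = e1 \<or> e = e2" using eq_e1 eq_e2 by linarith
    ultimately show "e = max e1 e2" by auto
  qed
qed

end
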